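(* Let $F_0\in\mathbb{R}^3$, $F,G_1,G_2\in\mathbb{R}^{3\times3}$ and $H_1,H_2\in\mathbb{R}^{1\times3}$ be the coefficients of the bilinear quantum stochastic differential equation $$dx=F_0\,dt+Fx\,dt+G_1x\,d\bar W_1+G_2x\,d\bar W_2$$ with output equation $$\begin{pmatrix} d\bar Y_1\\ d\bar Y_2\end{pmatrix}=\begin{pmatrix}H_1\\H_2\end{pmatrix}x\,dt+\begin{pmatrix} d\bar W_1\\ d\bar W_2\end{pmatrix}.$$ If this system is physically realizable, then $$G_1+G_1^T=G_2+G_2^T=0,$$ $$G_1G_2^T-G_2G_1^T-\Theta(F_0)=0,$$ $$F^T+F+G_1G_1^T+G_2G_2^T=0.$$
   Context: $\mathbf{i}$ is the imaginary unit. For a complex vector or matrix $M$, $M^T$ is the transpose, $M^\#$ the entrywise complex conjugate, $M^\dagger=(M^\#)^T$ the conjugate transpose; $I$ is the identity matrix. For $\beta\in\mathbb{C}^3$ (a row or a column vector) define $$\Theta(\beta)=\begin{pmatrix}0&\beta_3&-\beta_2\\-\beta_3&0&\beta_1\\ \beta_2&-\beta_1&0\end{pmatrix}.$$ Here $x=(x_1,x_2,x_3)^T$ is the vector of (self-adjoint) spin operators of an open two-level quantum system, and $\bar W_1,\bar W_2$ (inputs) and $\bar Y_1,\bar Y_2$ (outputs) are quadrature boson fields. Definition (physically realizable). The system with coefficients $(F_0,F,G_1,G_2,H_1,H_2)$ is physically realizable if there exist a Hamiltonian $\mathcal H=\alpha x$ with $\alpha\in\mathbb{R}^{1\times3}$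 and a coupling operator $L=\Lambda x$ with $\Lambda\in\mathbb{C}^{1\times 3}$ (row vectors) such that $$F_0=-2\mathbf{i}\,\Theta(\Lambda)\Lambda^\dagger,\qquad F=-2\Theta(\alpha)+\Lambda^\dagger\Lambda+\Lambda^T\Lambda^\#-2\Lambda\Lambda^\dagger I,$$ $$G_1=\Theta\big(\mathbf{i}(\Lambda^\#-\Lambda)\big),\qquad G_2=-\Theta(\Lambda+\Lambda^\#),\qquad H_1=\Lambda+\Lambda^\#,\qquad H_2=\mathbf{i}(\Lambda^\#-\Lambda).$$ (Here $\Lambda\Lambda^\dagger$ is a scalar.) Physical realizability is thus a condition on the coefficient matrices only. *)

theory Defs
  imports "HOL-Analysis.Analysis"
begin

text \<open>
  Row vectors of length 3 are matrices of type \<open>'a^3^1\<close>, so that \<open>\<Lambda>\<^sup>\<dagger> \<Lambda>\<close> is a 3 by 3 matrix and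
  \<open>\<Lambda> \<Lambda>\<^sup>\<dagger>\<close> a 1 by 1 matrix, both via \<open>**\<close>.  The operator \<open>\<Theta>\<close> takes the underlying vector in
  \<open>'a^3\<close>; it is applied to a row vector \<open>B\<close> as \<open>Theta (row 1 B)\<close>.
\<close>

definition Theta :: "'a::comm_ring_1^3 \<Rightarrow> 'a^3^3" where
  "Theta b = vector [vector [0, b $ 3, - (b $ 2)],
                     vector [- (b $ 3), 0, b $ 1],
                     vector [b $ 2, - (b $ 1), 0]]"

definition matrix_cnj :: "complex^'n^'m \<Rightarrow> complex^'n^'m" where
  "matrix_cnj M = map_matrix cnj M"

definition dagger :: "complex^'n^'m \<Rightarrow> complex^'m^'n" where
  "dagger M = transpose (matrix_cnj M)"

definition matrix_scale :: "'a::times \<Rightarrow> 'a^'n^'m \<Rightarrow> 'a^'n^'m" (infixr \<open>*ms\<close> 75) where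
  "c *ms M = map_matrix ((*) c) M"

abbreviation complex_matrix :: "real^'n^'m \<Rightarrow> complex^'n^'m" where
  "complex_matrix \<equiv> map_matrix complex_of_real"

text \<open>
  \<open>\<alpha>\<close> and \<open>\<Lambda>\<close> are the coefficients of the Hamiltonian \<open>\<alpha> x\<close> and of the coupling operator \<open>\<Lambda> x\<close>.
  The system coefficients are real, whereas the right-hand sides are complex expressions; the
  equations are therefore stated over the complex numbers.
\<close>

definition physically_realizable ::
  "real^3 \<Rightarrow> real^3^3 \<Rightarrow> real^3^3 \<Rightarrow> real^3^3 \<Rightarrow> real^3^1 \<Rightarrow> real^3^1 \<Rightarrow> bool" where
  "physically_realizable F0 F G1 G2 H1 H2 \<longleftrightarrow>
    (\<exists>(\<alpha> :: real^3^1) (\<Lambda> :: complex^3^1).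
      complex_matrix (columnvector F0 :: real^1^3)
        = (- 2 * \<i>) *ms (Theta (row 1 \<Lambda>) ** dagger \<Lambda>) \<and>
      complex_matrix F
        = (- 2) *ms Theta (row 1 (complex_matrix \<alpha>))
          + dagger \<Lambda> ** \<Lambda> + transpose \<Lambda> ** matrix_cnj \<Lambda>
          - (2 * (\<Lambda> ** dagger \<Lambda>) $ 1 $ 1) *ms mat 1 \<and>
      complex_matrix G1 = Theta (row 1 (\<i> *ms (matrix_cnj \<Lambda> - \<Lambda>))) \<and>
      complex_matrix G2 = - Theta (row 1 (\<Lambda> + matrix_cnj \<Lambda>)) \<and>
      complex_matrix H1 = \<Lambda> + matrix_cnj \<Lambda> \<and>
      complex_matrix H2 = \<i> *ms (matrix_cnj \<Lambda> - \<Lambda>))"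

end

theory Submission
  imports Defs
begin

text \<open>
  Splitting \<open>\<Lambda> = u + \<i> v\<close> into real and imaginary parts turns the coefficients into real vector
  algebra: \<open>F\<^sub>0 = 4 (u \<times> v)\<close>, \<open>G\<^sub>1 = 2 \<Theta>(v)\<close>, \<open>G\<^sub>2 = - 2 \<Theta>(u)\<close>, and the symmetric part of \<open>F\<close> is
  \<open>2 (u u\<^sup>T + v v\<^sup>T) - 2 (|u|\<^sup>2 + |v|\<^sup>2) I\<close>.  As \<open>\<Theta>(b) c = - b \<times> c\<close>, the second relation is the Jacobi
  identity for the cross product, and the third is \<open>\<Theta>(b) \<Theta>(b)\<^sup>T = |b|\<^sup>2 I - b b\<^sup>T\<close>.
\<close>

lemma Theta_nth [simp]:
  "Theta b $ 1 $ 1 = 0" "Theta b $ 1 $ 2 = b $ 3" "Theta b $ 1 $ 3 = - (b $ 2)"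
  "Theta b $ 2 $ 1 = - (b $ 3)" "Theta b $ 2 $ 2 = 0" "Theta b $ 2 $ 3 = b $ 1"
  "Theta b $ 3 $ 1 = b $ 2" "Theta b $ 3 $ 2 = - (b $ 1)" "Theta b $ 3 $ 3 = 0"
  by (simp_all add: Theta_def)

lemma Theta_minus: "Theta (- b) = - Theta b"
  by (simp add: vec_eq_iff forall_3)

lemma transpose_Theta: "transpose (Theta b) = - Theta b"
  by (simp add: vec_eq_iff forall_3 transpose_def)

text \<open>On a vector c this reads a x (b x c) - b x (a x c) = (a x b) x c; the minus sign in
  Theta(b) c = - b x c swaps the factors in \<open>cross3 b a\<close>.\<close>

lemma Theta_commutator:
  "Theta a ** Theta b - Theta b ** Theta a = Theta (cross3 b a)"
  by (simp add: vec_eq_iff forall_3 matrix_matrix_mult_def sum_3 cross3_def algebra_simps)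

text \<open>By skewness the product is -Theta(b)^2, so this is b x (b x c) = (b . c) b - |b|^2
  c.\<close>

lemma Theta_mult_transpose:
  fixes b :: "real^3"
  shows "Theta b ** transpose (Theta b) = (\<chi> i j. (if i = j then b \<bullet> b else 0) - b $ i * b $ j)"
  by (simp add: vec_eq_iff forall_3 matrix_matrix_mult_def sum_3 inner_vec_def transpose_def
      algebra_simps)

lemma physically_realizable_real_form:
  assumes "physically_realizable F0 F G1 G2 H1 H2"
  obtains a u v :: "real^3" where
    "F0 = 4 *\<^sub>R cross3 u v"
    "F = (\<chi> i j. - 2 * Theta a $ i $ j + 2 * (u $ i * u $ j + v $ i * v $ j)
                  - (if i = j then 2 * (u \<bullet> u + v \<bullet> v) else 0))"
    "G1 = Theta (2 *\<^sub>R v)"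
    "G2 = - Theta (2 *\<^sub>R u)"
proof -
  obtain \<alpha> :: "real^3^1" and \<Lambda> :: "complex^3^1" where
    F0: "complex_matrix (columnvector F0 :: real^1^3)
          = (- 2 * \<i>) *ms (Theta (row 1 \<Lambda>) ** dagger \<Lambda>)" and
    F: "complex_matrix F
          = (- 2) *ms Theta (row 1 (complex_matrix \<alpha>))
            + dagger \<Lambda> ** \<Lambda> + transpose \<Lambda> ** matrix_cnj \<Lambda>
            - (2 * (\<Lambda> ** dagger \<Lambda>) $ 1 $ 1) *ms mat 1" and
    G1: "complex_matrix G1 = Theta (row 1 (\<i> *ms (matrix_cnj \<Lambda> - \<Lambda>)))" and
    G2: "complex_matrix G2 = - Theta (row 1 (\<Lambda> + matrix_cnj \<Lambda>))"
    using assms unfolding physically_realizable_def by blast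
  define u v :: "real^3" where "u = (\<chi> i. Re (\<Lambda> $ 1 $ i))" and "v = (\<chi> i. Im (\<Lambda> $ 1 $ i))"
  note entries = vec_eq_iff forall_3 forall_1 map_matrix_def columnvector_def matrix_scale_def
    matrix_cnj_def dagger_def transpose_def row_def matrix_matrix_mult_def mat_def sum_3 sum_1
    complex_eq_iff
  show thesis
  proof (rule that)
    \<comment> \<open>Theta(\<Lambda>) applied to the conjugate of \<Lambda> is 2 \<i> (u x v); the
      prefactor -2 \<i> turns this into 4 (u x v).\<close>
    show "F0 = 4 *\<^sub>R cross3 u v"
      using F0 by (simp add: entries u_def v_def cross3_def algebra_simps)
    \<comment> \<open>The two outer products are conjugate to each other, so their imaginary parts
      cancel and their real parts double.\<close>
    show "F = (\<chi> i j. - 2 * Theta (row 1 \<alpha>) $ i $ j + 2 * (u $ i * u $ j + v $ i * v $ j)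
                  - (if i = j then 2 * (u \<bullet> u + v \<bullet> v) else 0))"
      using F by (simp add: entries u_def v_def inner_vec_def algebra_simps)
    show "G1 = Theta (2 *\<^sub>R v)"
      using G1 by (simp add: entries v_def)
    show "G2 = - Theta (2 *\<^sub>R u)"
      using G2 by (simp add: entries u_def)
  qed
qed

theorem theorem3:
  fixes F0 :: "real^3" and F G1 G2 :: "real^3^3" and H1 H2 :: "real^3^1"
  assumes "physically_realizable F0 F G1 G2 H1 H2"
  shows "G1 + transpose G1 = 0 \<and> G2 + transpose G2 = 0 \<and>
    G1 ** transpose G2 - G2 ** transpose G1 - Theta F0 = 0 \<and>
    transpose F + F + G1 ** transpose G1 + G2 ** transpose G2 = 0"
proof -
  obtain a u v :: "real^3" where
    F0: "F0 = 4 *\<^sub>R cross3 u v" and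
    F: "F = (\<chi> i j. - 2 * Theta a $ i $ j + 2 * (u $ i * u $ j + v $ i * v $ j)
                  - (if i = j then 2 * (u \<bullet> u + v \<bullet> v) else 0))" and
    G1: "G1 = Theta (2 *\<^sub>R v)" and
    G2: "G2 = - Theta (2 *\<^sub>R u)"
    using assms by (rule physically_realizable_real_form)
  have skew: "G1 + transpose G1 = 0" "G2 + transpose G2 = 0"
    unfolding G1 G2 Theta_minus [symmetric] by (simp_all only: transpose_Theta right_minus)
  have "G1 ** transpose G2 - G2 ** transpose G1
      = Theta (2 *\<^sub>R v) ** Theta (2 *\<^sub>R u) - Theta (2 *\<^sub>R u) ** Theta (2 *\<^sub>R v)"
    by (simp add: G1 G2 vec_eq_iff forall_3 matrix_matrix_mult_def transpose_def sum_3)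
  also have "\<dots> = Theta F0"
    by (simp add: Theta_commutator F0 cross_mult_left cross_mult_right)
  finally have comm: "G1 ** transpose G2 - G2 ** transpose G1 - Theta F0 = 0"
    by simp
  \<comment> \<open>The skew term in a cancels in F^T + F, leaving 4 (u u^T + v v^T) - 4 (|u|^2 +
    |v|^2) I. The squares of the arguments 2 v and - 2 u supply the opposite.\<close>
  have "transpose F + F + G1 ** transpose G1 + G2 ** transpose G2 = 0"
    unfolding G1 G2 Theta_minus [symmetric] Theta_mult_transpose
    by (simp add: F vec_eq_iff forall_3 transpose_def inner_vec_def sum_3 algebra_simps)
  with skew comm show ?thesis
    by blast
qed

end
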